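(* Suppose that $(\Omega,\mu,\tau,\alpha)$ is a continued fraction mixing, probability preserving fibered system and that $\Phi:\Omega\to\mathbb{N}$ is $\alpha$-measurable. Then $$\mathfrak{e}(\Phi,\tau)=\begin{cases}0\ \ \mu\text{-a.s.} & \text{if } \mathbb{E}(\Phi)<\infty,\\ \infty\ \ \mu\text{-a.s.} & \text{if } \mathbb{E}(\Phi)=\infty.\end{cases}$$
   Context: $\mathbb{N}=\{1,2,3,\dots\}$ and $\mathbb{E}(\Phi)=\int_\Omega\Phi\,d\mu$. Extravagance. For a sequence $(x_n)_{n\ge1}$ in $[0,\infty)$, not identically $0$, set $\mathbbm{e}((x_n)):=\limsup_{n\to\infty}\frac{x_{n+1}}{\sum_{k=1}^n x_k}\in[0,\infty]$; for the zero sequence set $\mathbbm{e}(\overline 0):=0$. For a probability preserving transformation $\tau$ of $(\Omega,\mu)$ and a measurable $\Phi:\Omega\to[0,\infty)$, the extravagance is the random variable $\mathfrak{e}(\Phi,\tau)(\omega):=\mathbbm{e}((\Phi(\tau^n\omega):n\ge0))$, i.e. (if some $\Phi(\tau^n\omega)>0$) $\limsup_{n\to\infty}\Phi(\tau^n\omega)/\sum_{k=0}^{n-1}\Phi(\tau^k\omega)$. Fibered system. A probability preserving fibered system $(\Omega,\mu,\tau,\alpha)$ is a probability preserving transformation $\tau$ of a standard probability space $(\Omega,\mu)$ equipped with a countable (or finite) measurable partition $\alpha$ such that $\sigma(\{\tau^{-n}\alpha:n\ge0\})=\mathcal{B}(\Omega)$ (mod $\mu$) and such that $\tau:a\to\tau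 a$ is invertible and nonsingular for every $a\in\alpha$. Continued fraction mixing. The fibered system is continued fraction mixing if there is a sequence of numbers $\vartheta(N)\ge 0$ ($N\ge1$) with $\vartheta(N)\downarrow0$ such that for all $n,N\ge1$, all $A\in\sigma(\{\tau^{-k}\alpha:0\le k\le n\})$ and all $B\in\sigma(\{\tau^{-\ell}\alpha:\ell\ge n+N\})$, $$|\mu(A\cap B)-\mu(A)\mu(B)|\le\vartheta(N)\mu(A)\mu(B).$$ $\Phi$ is $\alpha$-measurable if it is measurable with respect to $\sigma(\alpha)$. *)

theory Defs
  imports "HOL-Probability.Probability"
begin

definition standard_borel_space :: "'a measure \<Rightarrow> bool" where
  "standard_borel_space M \<longleftrightarrow>
     (\<exists>X. completely_metrizable_space X \<and> second_countable X \<and>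
          topspace X = space M \<and> sets M = sigma_sets (topspace X) {U. openin X U})"

locale standard_prob_space = prob_space +
  assumes standard_borel: "standard_borel_space M"

locale prob_preserving = standard_prob_space +
  fixes \<tau> :: "'a \<Rightarrow> 'a"
  assumes measurable_\<tau>: "\<tau> \<in> M \<rightarrow>\<^sub>M M"
    and distr_\<tau>: "distr M M \<tau> = M"

(* Nonsingular: the image measure and the measure on the target have the same null sets. *)
definition nonsingular :: "'a measure \<Rightarrow> 'b measure \<Rightarrow> ('a \<Rightarrow> 'b) \<Rightarrow> bool" where
  "nonsingular M N f \<longleftrightarrow> f \<in> M \<rightarrow>\<^sub>M N \<and> null_sets (distr M N f) = null_sets N"

definition measurably_invertible :: "'a measure \<Rightarrow> 'b measure \<Rightarrow> ('a \<Rightarrow> 'b) \<Rightarrow> bool" where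
  "measurably_invertible M N f \<longleftrightarrow>
     f \<in> M \<rightarrow>\<^sub>M N \<and> bij_betw f (space M) (space N) \<and> the_inv_into (space M) f \<in> N \<rightarrow>\<^sub>M M"

(* The sigma-algebra generated by the partitions \<tau>\<^sup>-\<^sup>k\<alpha>, k \<in> K. *)
definition sigma_pullbacks ::
  "'a measure \<Rightarrow> ('a \<Rightarrow> 'a) \<Rightarrow> 'a set set \<Rightarrow> nat set \<Rightarrow> 'a set set" where
  "sigma_pullbacks M \<tau> \<alpha> K =
     sigma_sets (space M) {(\<tau> ^^ k) -` a \<inter> space M | k a. k \<in> K \<and> a \<in> \<alpha>}"

locale fibered_system = prob_preserving +
  fixes \<alpha> :: "'a set set"
  assumes partition: "partition_on (space M) \<alpha>"
    and countable_partition: "countable \<alpha>"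
    and partition_measurable: "\<alpha> \<subseteq> sets M"
    and generating: "\<And>B. B \<in> sets M \<Longrightarrow>
      \<exists>A \<in> sigma_pullbacks M \<tau> \<alpha> UNIV. (A - B) \<union> (B - A) \<in> null_sets M"
    and branch_image: "\<And>a. a \<in> \<alpha> \<Longrightarrow> \<tau> ` a \<in> sets M"
    and branch_invertible: "\<And>a. a \<in> \<alpha> \<Longrightarrow>
      measurably_invertible (restrict_space M a) (restrict_space M (\<tau> ` a)) \<tau>"
    and branch_nonsingular: "\<And>a. a \<in> \<alpha> \<Longrightarrow>
      nonsingular (restrict_space M a) (restrict_space M (\<tau> ` a)) \<tau>"

definition continued_fraction_mixing ::
  "'a measure \<Rightarrow> ('a \<Rightarrow> 'a) \<Rightarrow> 'a set set \<Rightarrow> bool" where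
  "continued_fraction_mixing M \<tau> \<alpha> \<longleftrightarrow>
     (\<exists>\<theta> :: nat \<Rightarrow> real.
        (\<forall>N\<ge>1. 0 \<le> \<theta> N) \<and> antimono_on {1..} \<theta> \<and> \<theta> \<longlonglongrightarrow> 0 \<and>
        (\<forall>n\<ge>1. \<forall>N\<ge>1. \<forall>A \<in> sigma_pullbacks M \<tau> \<alpha> {0..n}. \<forall>B \<in> sigma_pullbacks M \<tau> \<alpha> {n + N..}.
           \<bar>measure M (A \<inter> B) - measure M A * measure M B\<bar> \<le> \<theta> N * measure M A * measure M B))"

(* Sequences are indexed from 1; the value x 0 is ignored. For a nonzero sequence in [0,\<infinity>) the
   partial sums are eventually positive, so division by 0 does not affect the limsup. *)
definition seq_extravagance :: "(nat \<Rightarrow> real) \<Rightarrow> ennreal" where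
  "seq_extravagance x =
     (if \<forall>n\<ge>1. x n = 0 then 0
      else limsup (\<lambda>n. ennreal (x (n + 1) / (\<Sum>k=1..n. x k))))"

definition extravagance :: "('a \<Rightarrow> real) \<Rightarrow> ('a \<Rightarrow> 'a) \<Rightarrow> 'a \<Rightarrow> ennreal" where
  "extravagance \<Phi> \<tau> \<omega> = seq_extravagance (\<lambda>n. \<Phi> ((\<tau> ^^ (n - 1)) \<omega>))"

end

theory Submission
  imports Defs
begin

text \<open>
  Write \<open>X\<^sub>n = \<Phi> \<circ> \<tau>^n\<close> and \<open>S\<^sub>n = X\<^sub>0 + \<dots> + X\<^sub>n\<^sub>-\<^sub>1 \<ge> n\<close>. If \<open>\<Phi>\<close> is integrable, Borel--Cantelli gives
  \<open>X\<^sub>n / n \<rightarrow> 0\<close>, hence extravagance 0.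

  Otherwise let \<open>L t = E (min \<Phi> t)\<close> and let \<open>t\<^sub>n\<close> be the least \<open>t \<ge> 1\<close> with \<open>n L(t) \<le> c t\<close>, where
  \<open>c = 1 / (2 (1 + \<theta> 1))\<close>. Markov's inequality for truncated sums gives \<open>P (S\<^sub>n > t\<^sub>n) \<le> c\<close>, so by the
  upper mixing bound with gap 1 the event \<open>A\<^sub>n = {X\<^sub>n > K t\<^sub>n, S\<^sub>n \<le> t\<^sub>n}\<close> has at least half the
  probability of \<open>{X\<^sub>n > K t\<^sub>n}\<close>. These probabilities have infinite sum because \<open>E (\<Phi> / L \<Phi>) = \<infinity>\<close>.
  The Kochen--Stone lemma, again with the upper mixing bound, shows that \<open>X\<^sub>n > K S\<^sub>n\<close> infinitely
  often with positive probability. Dropping finitely many terms from \<open>S\<^sub>n\<close> turns this into a tail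
  event, whose probability is 0 or 1 since \<open>\<theta> N \<rightarrow> 0\<close>; as \<open>S\<^sub>n \<rightarrow> \<infinity>\<close>, the dropped terms cost only
  a factor 2 in \<open>K\<close>.
\<close>

section \<open>A Borel--Cantelli lemma under quasi-independence\<close>

text \<open>Second moment method: for the number \<open>Z\<close> of events occurring in a block,
  quasi-independence bounds the mean of \<open>Z^2\<close> by a multiple of the squared mean of
  \<open>Z\<close>. Hence some event of the block occurs with probability bounded below,
  independently of where the block starts.\<close>

lemma (in prob_space) kochen_stone:
  fixes A :: "nat \<Rightarrow> 'a set"
  assumes ev[measurable]: "\<And>n. A n \<in> events"
    and div: "\<not> summable (\<lambda>n. prob (A n))"
    and C: "0 \<le> C"
    and quasi: "\<And>m n. k \<le> m \<Longrightarrow> m < n \<Longrightarrow> prob (A m \<inter> A n) \<le> C * prob (A m) * prob (A n)"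
  shows "1 / (C + 1) \<le> prob {\<omega> \<in> space M. \<exists>\<^sub>\<infinity>n. \<omega> \<in> A n}"
proof -
  define U where "U m = (\<Union>n\<in>{m..}. A n)" for m
  have U[measurable]: "U m \<in> events" for m
    unfolding U_def by measurable
  have block: "1 / (C + 1) \<le> prob (U m)" if m: "k \<le> m" for m
  proof -
    \<comment> \<open>The first \<open>m\<close> probabilities add up to at most \<open>m\<close>,
      so the block from \<open>m\<close> to \<open>n\<close> keeps a sum \<open>s > 1\<close>. This
      lets the diagonal contribution \<open>s\<close> to the second moment be absorbed into
      \<open>s^2\<close>.\<close>
    have "\<exists>n. real m + 1 < (\<Sum>i<n. prob (A i))"
    proof (rule ccontr)
      assume "\<nexists>n. real m + 1 < (\<Sum>i<n. prob (A i))"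
      then have "(\<Sum>i<n. prob (A i)) \<le> real m + 1" for n
        by (auto simp: not_less)
      then have "summable (\<lambda>n. prob (A n))"
        by (intro summableI_nonneg_bounded) auto
      with div show False by simp
    qed
    then obtain n where n: "real m + 1 < (\<Sum>i<n. prob (A i))" by blast
    define I where "I = {m..<n}"
    define s where "s = (\<Sum>i\<in>I. prob (A i))"
    have I: "finite I" by (simp add: I_def)
    have "(\<Sum>i<n. prob (A i)) \<le> (\<Sum>i\<in>{..<m} \<union> I. prob (A i))"
      by (rule sum_mono2) (auto simp: I_def)
    also have "\<dots> = (\<Sum>i<m. prob (A i)) + s"
      unfolding s_def by (rule sum.union_disjoint) (auto simp: I_def)
    also have "(\<Sum>i<m. prob (A i)) \<le> (\<Sum>i<m. 1)"
      by (rule sum_mono) simp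
    finally have s1: "1 < s" using n by simp
    define Z :: "'a \<Rightarrow> real" where "Z \<omega> = (\<Sum>i\<in>I. indicator (A i) \<omega>)" for \<omega>
    have int_ind: "integrable M (indicator B :: 'a \<Rightarrow> real)" if "B \<in> events" for B
      using that by (intro integrable_real_indicator) (auto simp: emeasure_eq_measure)
    have Z_int: "integrable M Z"
      unfolding Z_def[abs_def] by (intro Bochner_Integration.integrable_sum int_ind ev)
    have EZ: "expectation Z = s"
      unfolding Z_def[abs_def] s_def
      by (subst Bochner_Integration.integral_sum) (auto intro!: int_ind)
    have Z2: "(Z \<omega>)\<^sup>2 = (\<Sum>i\<in>I. \<Sum>j\<in>I. indicator (A i \<inter> A j) \<omega>)" for \<omega>
      unfolding Z_def power2_eq_square sum_product
      by (intro sum.cong refl) (auto simp: indicator_def)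
    have Z2_int: "integrable M (\<lambda>\<omega>. (Z \<omega>)\<^sup>2)"
      unfolding Z2 by (intro Bochner_Integration.integrable_sum int_ind sets.Int ev)
    have "expectation (\<lambda>\<omega>. (Z \<omega>)\<^sup>2) = (\<Sum>i\<in>I. \<Sum>j\<in>I. prob (A i \<inter> A j))"
      unfolding Z2
      by (simp add: Bochner_Integration.integral_sum int_ind Bochner_Integration.integrable_sum)
    also have "\<dots> \<le> (\<Sum>i\<in>I. \<Sum>j\<in>I. C * prob (A i) * prob (A j) + (if i = j then prob (A i) else 0))"
    proof (intro sum_mono)
      fix i j assume ij: "i \<in> I" "j \<in> I"
      then have k: "k \<le> i" "k \<le> j" using m by (auto simp: I_def)
      show "prob (A i \<inter> A j) \<le> C * prob (A i) * prob (A j) + (if i = j then prob (A i) else 0)"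
        using quasi[of i j] quasi[of j i] k C
        by (cases i j rule: linorder_cases) (auto simp: Int_commute mult.commute mult.left_commute)
    qed
    also have "\<dots> = C * s\<^sup>2 + s"
      unfolding s_def power2_eq_square sum_product
      by (simp add: sum.distrib I sum_distrib_left mult.assoc)
    also have "\<dots> \<le> (C + 1) * s\<^sup>2"
      using s1 by (simp add: power2_eq_square distrib_right)
    finally have EZ2: "expectation (\<lambda>\<omega>. (Z \<omega>)\<^sup>2) \<le> (C + 1) * s\<^sup>2" .
    \<comment> \<open>\<open>l\<close> optimizes the lower bound for \<open>prob (U m)\<close> obtained from \<open>E (1\<^sub>U - l Z)\<^sup>2 \<ge> 0\<close>.\<close>
    define l where "l = 1 / ((C + 1) * s)"
    have eq: "(indicator (U m) \<omega> - l * Z \<omega>)\<^sup>2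
        = indicator (U m) \<omega> - 2 * l * Z \<omega> + l\<^sup>2 * (Z \<omega>)\<^sup>2" for \<omega>
    proof -
      \<comment> \<open>\<open>Z\<close> vanishes off \<open>U m\<close>, so in the expanded square
        the product of the indicator and \<open>Z\<close> is \<open>Z\<close> itself.\<close>
      have "Z \<omega> = 0" if "\<omega> \<notin> U m"
        unfolding Z_def using that by (intro sum.neutral) (auto simp: U_def I_def)
      then show ?thesis
        by (cases "\<omega> \<in> U m") (auto simp: power2_eq_square algebra_simps)
    qed
    have "0 \<le> expectation (\<lambda>\<omega>. (indicator (U m) \<omega> - l * Z \<omega>)\<^sup>2)"
      by simp
    also have "\<dots> = prob (U m) - 2 * l * s + l\<^sup>2 * expectation (\<lambda>\<omega>. (Z \<omega>)\<^sup>2)"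
      unfolding eq using Z_int Z2_int EZ by (simp add: int_ind)
    also have "\<dots> \<le> prob (U m) - 2 * l * s + l\<^sup>2 * ((C + 1) * s\<^sup>2)"
      by (intro add_left_mono mult_left_mono EZ2) simp
    also have "2 * l * s = 2 / (C + 1)"
      using s1 C by (simp add: l_def)
    also have "l\<^sup>2 * ((C + 1) * s\<^sup>2) = 1 / (C + 1)"
      using s1 C by (simp add: l_def power2_eq_square)
    finally show ?thesis by simp
  qed
  have "(\<lambda>m. prob (U m)) \<longlonglongrightarrow> prob (\<Inter>m. U m)"
    by (rule finite_Lim_measure_decseq) (use U in \<open>auto simp: decseq_def U_def intro: order.trans\<close>)
  then have "1 / (C + 1) \<le> prob (\<Inter>m. U m)"
    by (rule LIMSEQ_le_const) (use block in blast)
  also have "(\<Inter>m. U m) = {\<omega> \<in> space M. \<exists>\<^sub>\<infinity>n. \<omega> \<in> A n}"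
    using sets.sets_into_space[OF ev] by (fastforce simp: U_def INFM_nat_le)
  finally show ?thesis .
qed

section \<open>Truncated means\<close>

context prob_space
begin

text \<open>Capping at \<open>t\<close>, rather than discarding the values above \<open>t\<close>,
  makes \<open>trunc_mean f t / t\<close> nonincreasing for \<open>t >= 1\<close>.\<close>

definition trunc_mean :: "('a \<Rightarrow> nat) \<Rightarrow> nat \<Rightarrow> real" where
  "trunc_mean f t = expectation (\<lambda>\<omega>. min (real (f \<omega>)) (real t))"

context
  fixes f :: "'a \<Rightarrow> nat"
  assumes f[measurable]: "f \<in> M \<rightarrow>\<^sub>M count_space UNIV"
begin

lemma integrable_trunc: "integrable M (\<lambda>\<omega>. min (real (f \<omega>)) (real t))"
  by (rule integrable_const_bound[where B = "real t"]) auto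

lemma trunc_mean_nonneg: "0 \<le> trunc_mean f t"
  unfolding trunc_mean_def by (rule Bochner_Integration.integral_nonneg) auto

lemma trunc_mean_mono: "s \<le> t \<Longrightarrow> trunc_mean f s \<le> trunc_mean f t"
  unfolding trunc_mean_def by (intro integral_mono integrable_trunc) auto

lemma trunc_mean_ge_1:
  assumes "\<And>\<omega>. \<omega> \<in> space M \<Longrightarrow> 1 \<le> f \<omega>" "1 \<le> t"
  shows "1 \<le> trunc_mean f t"
proof -
  have "(\<integral>\<omega>. 1 \<partial>M) \<le> trunc_mean f t"
    unfolding trunc_mean_def using assms by (intro integral_mono integrable_trunc) fastforce+
  then show ?thesis by (simp add: prob_space)
qed

text \<open>For a fixed value \<open>x >= 0\<close> the quotient \<open>min x t / t\<close> is
  nonincreasing in \<open>t\<close>. Both denominators are multiplied out.\<close>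

lemma trunc_mean_div_antimono:
  assumes "1 \<le> s" "s \<le> t"
  shows "s * trunc_mean f t \<le> t * trunc_mean f s"
proof -
  have "expectation (\<lambda>\<omega>. s * min (real (f \<omega>)) (real t)) \<le> expectation (\<lambda>\<omega>. t * min (real (f \<omega>)) (real s))"
  proof (intro integral_mono integrable_mult_right integrable_trunc)
    fix \<omega>
    show "s * min (real (f \<omega>)) (real t) \<le> t * min (real (f \<omega>)) (real s)"
      using assms mult_mono[of s t "f \<omega>" "f \<omega>"] mult_mono[of s t s s] mult_mono[of s s "f \<omega>" t]
      by (auto simp: min_def mult.commute simp flip: of_nat_mult)
  qed
  then show ?thesis by (simp add: trunc_mean_def)
qed

text \<open>Dominated convergence with the constant bound 1, so an infinite mean of \<open>f\<close>
  is allowed. This later guarantees that the scales \<open>t n\<close> exist.\<close>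

lemma trunc_mean_div_tendsto_0: "(\<lambda>t. trunc_mean f t / real t) \<longlonglongrightarrow> 0"
proof -
  have "(\<lambda>t. expectation (\<lambda>\<omega>. min (real (f \<omega>)) (real t) / real t)) \<longlonglongrightarrow> expectation (\<lambda>\<omega>. 0)"
  proof (rule integral_dominated_convergence[where w = "\<lambda>_. 1"])
    show "AE \<omega> in M. (\<lambda>t. min (real (f \<omega>)) (real t) / real t) \<longlonglongrightarrow> 0"
    proof (intro AE_I2)
      fix \<omega>
      have "(\<lambda>t. real (f \<omega>) / real t) \<longlonglongrightarrow> 0"
        by (rule tendsto_divide_0[OF tendsto_const filterlim_at_top_imp_at_infinity[OF filterlim_real_sequentially]])
      then show "(\<lambda>t. min (real (f \<omega>)) (real t) / real t) \<longlonglongrightarrow> 0"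
        by (rule tendsto_sandwich[OF _ _ tendsto_const, rotated -1]) (auto intro!: divide_right_mono always_eventually)
    qed
  qed (auto simp: divide_le_eq_1)
  then show ?thesis by (simp add: trunc_mean_def)
qed

text \<open>The capped functions increase to \<open>f\<close>, so by monotone convergence a common
  bound on their means would bound the integral of \<open>f\<close>.\<close>

lemma trunc_mean_unbounded:
  assumes "(\<integral>\<^sup>+\<omega>. ennreal (real (f \<omega>)) \<partial>M) = \<infinity>"
  shows "\<exists>t. B < trunc_mean f t"
proof (rule ccontr)
  assume "\<nexists>t. B < trunc_mean f t"
  then have B: "trunc_mean f t \<le> B" for t by (simp add: not_less)
  have sup: "ennreal (real x) = (SUP t::nat. ennreal (min (real x) (real t)))" for x :: nat
    by (rule antisym, rule SUP_upper2[of x]) (auto intro!: SUP_least ennreal_leI)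
  have "(\<integral>\<^sup>+\<omega>. ennreal (real (f \<omega>)) \<partial>M) = (SUP t::nat. \<integral>\<^sup>+\<omega>. ennreal (min (real (f \<omega>)) (real t)) \<partial>M)"
    unfolding sup
    by (rule nn_integral_monotone_convergence_SUP)
       (auto simp: incseq_def le_fun_def min_le_iff_disj intro!: ennreal_leI)
  also have "\<dots> = (SUP t::nat. ennreal (trunc_mean f t))"
    unfolding trunc_mean_def by (subst nn_integral_eq_integral[OF integrable_trunc]) auto
  also have "\<dots> \<le> ennreal B"
    by (intro SUP_least ennreal_leI B)
  finally show False using assms by (simp add: top_unique)
qed

text \<open>
  On \<open>{f > s}\<close> monotonicity of \<open>L\<close> and of \<open>t / L t\<close> gives \<open>f / L f \<ge> min f t / L t\<close> for every \<open>t\<close>, so the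
  integral over \<open>{f > s}\<close> is at least \<open>(L t - s) / L t\<close>, which tends to 1 as \<open>t \<rightarrow> \<infinity>\<close>.
\<close>

lemma nn_integral_div_trunc_mean:
  assumes pos: "\<And>\<omega>. \<omega> \<in> space M \<Longrightarrow> 1 \<le> f \<omega>"
    and inf: "(\<integral>\<^sup>+\<omega>. ennreal (real (f \<omega>)) \<partial>M) = \<infinity>"
  shows "(\<integral>\<^sup>+\<omega>. ennreal (real (f \<omega>) / trunc_mean f (f \<omega>)) \<partial>M) = \<infinity>"
proof (rule ccontr)
  define g where "g \<omega> = real (f \<omega>) / trunc_mean f (f \<omega>)" for \<omega>
  have g0: "0 \<le> g \<omega>" for \<omega> by (simp add: g_def trunc_mean_nonneg)
  have g_meas[measurable]: "g \<in> borel_measurable M"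
    unfolding g_def by measurable
  assume "(\<integral>\<^sup>+\<omega>. ennreal (real (f \<omega>) / trunc_mean f (f \<omega>)) \<partial>M) \<noteq> \<infinity>"
  then have g_int: "integrable M g"
    by (intro integrableI_nonneg) (use g0 in \<open>auto simp: g_def top.not_eq_extremum\<close>)
  define h where "h s \<omega> = (if s < f \<omega> then g \<omega> else 0)" for s \<omega>
  have h_int: "integrable M (h s)" for s
    unfolding h_def[abs_def] by (rule Bochner_Integration.integrable_bound[OF g_int]) (auto simp: g0)
  \<comment> \<open>At each point \<open>h s\<close> is eventually 0 because \<open>f\<close> is
    finite there, and \<open>g\<close> dominates.\<close>
  have "(\<lambda>s. expectation (h s)) \<longlonglongrightarrow> expectation (\<lambda>\<omega>. 0)"
  proof (rule integral_dominated_convergence[OF _ _ g_int])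
    show "AE \<omega> in M. (\<lambda>s. h s \<omega>) \<longlonglongrightarrow> 0"
    proof (intro AE_I2 tendsto_eventually)
      fix \<omega>
      show "\<forall>\<^sub>F s in sequentially. h s \<omega> = 0"
        using eventually_ge_at_top[of "f \<omega>"] by eventually_elim (simp add: h_def)
    qed
  qed (use h_int in \<open>auto simp: h_def g0\<close>)
  then have "\<forall>\<^sub>F s in sequentially. expectation (h s) < 1/2"
    by (rule order_tendstoD) simp
  then obtain s where s: "expectation (h s) < 1/2"
    by (metis eventually_happens trivial_limit_sequentially)
  \<comment> \<open>A truncated mean \<open>L\<close> above \<open>2 * s + 1\<close> satisfies
    \<open>L - s > L / 2\<close>, which will contradict
    \<open>expectation (h s) < 1/2\<close>.\<close>
  obtain t0 where t0: "2 * real s + 1 < trunc_mean f t0"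
    using trunc_mean_unbounded[OF inf] by blast
  define t where "t = Suc t0"
  define L where "L = trunc_mean f t"
  have L: "2 * real s + 1 < L"
    using t0 trunc_mean_mono[of t0 t] by (simp add: L_def t_def)
  \<comment> \<open>Subtracting \<open>s\<close> makes the left integrand nonpositive where
    \<open>f <= s\<close>, which is where \<open>h s\<close> vanishes.\<close>
  have "expectation (\<lambda>\<omega>. min (real (f \<omega>)) (real t) - real s) \<le> expectation (\<lambda>\<omega>. L * h s \<omega>)"
  proof (intro integral_mono Bochner_Integration.integrable_diff integrable_trunc integrable_mult_right h_int integrable_const)
    fix \<omega> assume \<omega>: "\<omega> \<in> space M"
    have Lf: "1 \<le> trunc_mean f (f \<omega>)"
      using pos \<omega> by (intro trunc_mean_ge_1) auto
    show "min (real (f \<omega>)) (real t) - real s \<le> L * h s \<omega>"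
    proof (cases "s < f \<omega>")
      case True
      have "min (real (f \<omega>)) (real t) \<le> L * g \<omega>"
      proof (cases "f \<omega> \<le> t")
        case le: True
        have "real (f \<omega>) * trunc_mean f (f \<omega>) \<le> real (f \<omega>) * L"
          unfolding L_def by (intro mult_left_mono trunc_mean_mono le) simp
        then show ?thesis using Lf le by (simp add: g_def field_simps)
      next
        case False
        then have "t * trunc_mean f (f \<omega>) \<le> f \<omega> * L"
          unfolding L_def by (intro trunc_mean_div_antimono) (auto simp: t_def)
        then show ?thesis using Lf False by (simp add: g_def field_simps)
      qed
      then show ?thesis using True by (simp add: h_def)
    qed (auto simp: h_def)
  qed
  then have "L - real s \<le> L * expectation (h s)"
    using integrable_trunc by (simp add: L_def trunc_mean_def prob_space)
  also have "\<dots> \<le> L * (1/2)"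
    using s L by (intro mult_left_mono) auto
  finally show False using L by simp
qed

text \<open>
  Interchanging sum and integral, the series is the integral of the number of \<open>n\<close> with \<open>K * t n < f\<close>,
  and for \<open>f = x\<close> this number is at least of order \<open>x / L x\<close>.
\<close>

lemma not_summable_tail:
  assumes pos: "\<And>\<omega>. \<omega> \<in> space M \<Longrightarrow> 1 \<le> f \<omega>"
    and inf: "(\<integral>\<^sup>+\<omega>. ennreal (real (f \<omega>)) \<partial>M) = \<infinity>"
    and c: "0 < c" and K: "1 \<le> K"
    and t: "\<And>n s. 1 \<le> s \<Longrightarrow> real n * trunc_mean f s \<le> c * real s \<Longrightarrow> t n \<le> s"
  shows "\<not> summable (\<lambda>n. prob {\<omega> \<in> space M. K * t n < f \<omega>})"
proof
  assume sm: "summable (\<lambda>n. prob {\<omega> \<in> space M. K * t n < f \<omega>})"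
  define T where "T \<omega> = (\<Sum>n. indicator {\<omega> \<in> space M. K * t n < f \<omega>} \<omega> :: ennreal)" for \<omega>
  have "(\<integral>\<^sup>+\<omega>. T \<omega> \<partial>M) = (\<Sum>n. \<integral>\<^sup>+\<omega>. indicator {\<omega> \<in> space M. K * t n < f \<omega>} \<omega> \<partial>M)"
    unfolding T_def by (rule nn_integral_suminf) auto
  also have "\<dots> = (\<Sum>n. ennreal (prob {\<omega> \<in> space M. K * t n < f \<omega>}))"
    by (subst nn_integral_indicator, measurable) (simp only: emeasure_eq_measure)
  also have "\<dots> = ennreal (\<Sum>n. prob {\<omega> \<in> space M. K * t n < f \<omega>})"
    by (rule suminf_ennreal2[OF measure_nonneg sm])
  also have "\<dots> < \<infinity>"
    unfolding infinity_ennreal_def by (rule ennreal_less_top)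
  finally have T: "(\<integral>\<^sup>+\<omega>. T \<omega> \<partial>M) < \<infinity>" .
  \<comment> \<open>The factor \<open>a\<close> undoes the scalings \<open>x ~ K * s\<close> and
    \<open>N ~ c * s / L\<close> below. The summand \<open>c + 1\<close> pays for two roundings:
    \<open>c\<close> for the division by \<open>K\<close> and 1 for the floor.\<close>
  define a where "a = real K / c"
  have a: "0 < a" using c K by (simp add: a_def)
  have "ennreal (real (f \<omega>) / trunc_mean f (f \<omega>)) \<le> ennreal a * (T \<omega> + ennreal (c + 1))"
    if \<omega>: "\<omega> \<in> space M" for \<omega>
  proof -
    define x where "x = f \<omega>"
    \<comment> \<open>\<open>s\<close> is the largest number with \<open>K * s < x\<close>. If
      \<open>1 <= s\<close>, the hypothesis on \<open>t\<close> gives \<open>t n <= s\<close> for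
      every \<open>n\<close> up to \<open>c * s / trunc_mean f s\<close>, so each
      \<open>n < N\<close> is counted by \<open>T\<close>. The case \<open>s = 0\<close> is outside
      that hypothesis and gets \<open>N = 0\<close>.\<close>
    define s where "s = (x - 1) div K"
    define N where "N = (if s = 0 then 0 else nat \<lfloor>c * s / trunc_mean f s\<rfloor>)"
    define L where "L = trunc_mean f x"
    have x: "1 \<le> x" using pos \<omega> by (simp add: x_def)
    have L: "1 \<le> L" unfolding L_def using pos x by (rule trunc_mean_ge_1)
    have sK: "K * s < x"
      using x times_div_less_eq_dividend[of K "x - 1"] unfolding s_def by linarith
    have xs: "x \<le> K * (s + 1)"
    proof -
      have "x - 1 < K * (s + 1)"
        using K dividend_less_times_div[of K "x - 1"] by (simp add: s_def)
      then show ?thesis by linarith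
    qed
    have tn: "K * t n < x" if n: "n < N" for n
    proof -
      have s: "1 \<le> s" using n by (auto simp: N_def split: if_splits)
      have Ls: "1 \<le> trunc_mean f s" using pos s by (rule trunc_mean_ge_1)
      have "real n \<le> c * s / trunc_mean f s"
        using n s c Ls unfolding N_def by (auto split: if_splits) linarith
      then have "real n * trunc_mean f s \<le> c * s" using Ls by (simp add: field_simps)
      then have "t n \<le> s" by (rule t[OF s])
      then show ?thesis using sK by (meson le_less_trans mult_le_mono2)
    qed
    have "ennreal (real N) = (\<Sum>n<N. indicator {\<omega> \<in> space M. K * t n < f \<omega>} \<omega>)"
      using tn \<omega> by (simp add: x_def ennreal_of_nat_eq_real_of_nat)
    also have "\<dots> \<le> T \<omega>"
      unfolding T_def by (rule sum_le_suminf) auto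
    finally have NT: "ennreal (real N) \<le> T \<omega>" .
    have "c * s \<le> (real N + 1) * L"
    proof (cases "s = 0")
      case False
      then have s: "1 \<le> s" by simp
      have Ls: "1 \<le> trunc_mean f s" using pos s by (rule trunc_mean_ge_1)
      have "c * s / trunc_mean f s \<le> real N + 1"
        using False unfolding N_def by simp linarith
      then have "c * s \<le> (real N + 1) * trunc_mean f s"
        using Ls by (simp add: field_simps)
      also have "s \<le> x" unfolding s_def by (rule order.trans[OF div_le_dividend]) simp
      then have "trunc_mean f s \<le> L" unfolding L_def by (rule trunc_mean_mono)
      then have "(real N + 1) * trunc_mean f s \<le> (real N + 1) * L" by (intro mult_left_mono) auto
      finally show ?thesis .
    qed (use L in simp)
    moreover have "real x \<le> real K * (real s + 1)"
      using xs by (metis of_nat_1 of_nat_add of_nat_le_iff of_nat_mult)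
    then have "c * real x \<le> c * (real K * (real s + 1))" using c by (intro mult_left_mono) auto
    then have "c * real x \<le> real K * (c * s + c)" by (simp add: algebra_simps)
    moreover have "c \<le> c * L" using c L by simp
    ultimately have "c * real x \<le> real K * ((real N + 1) * L + c * L)"
      by (smt (verit) mult_left_mono of_nat_0_le_iff)
    then have "real x / L \<le> a * (real N + (c + 1))"
      using c L by (simp add: a_def field_simps)
    then have "ennreal (real x / L) \<le> ennreal (a * (real N + (c + 1)))"
      by (rule ennreal_leI)
    also have "\<dots> = ennreal a * (ennreal (real N) + ennreal (c + 1))"
      using a c ennreal_plus[of "real N" "c + 1"] by (simp add: ennreal_mult del: ennreal_plus)
    also have "\<dots> \<le> ennreal a * (T \<omega> + ennreal (c + 1))"
      by (intro mult_left_mono add_right_mono NT) simp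
    finally show ?thesis by (simp only: x_def L_def)
  qed
  then have "(\<integral>\<^sup>+\<omega>. ennreal (real (f \<omega>) / trunc_mean f (f \<omega>)) \<partial>M)
      \<le> (\<integral>\<^sup>+\<omega>. ennreal a * (T \<omega> + ennreal (c + 1)) \<partial>M)"
    by (rule nn_integral_mono)
  also have "\<dots> = ennreal a * ((\<integral>\<^sup>+\<omega>. T \<omega> \<partial>M) + ennreal (c + 1))"
  proof -
    have [measurable]: "T \<in> borel_measurable M"
      unfolding T_def[abs_def] by measurable
    show ?thesis
      by (subst nn_integral_cmult) (auto simp: nn_integral_add emeasure_space_1)
  qed
  also have "\<dots> < \<infinity>"
    using T by (simp add: ennreal_mult_less_top)
  finally show False
    using nn_integral_div_trunc_mean[OF pos inf] by simp
qed

end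

end


section \<open>Continued fraction mixing and tail events\<close>

lemma (in fibered_system) funpow_measurable[measurable]: "\<tau> ^^ k \<in> M \<rightarrow>\<^sub>M M"
  by (induction k) (auto intro: measurable_compose[OF _ measurable_\<tau>])

lemma (in fibered_system) distr_funpow: "distr M M (\<tau> ^^ k) = M"
proof (induction k)
  case 0
  show ?case by (simp add: id_def)
next
  case (Suc k)
  have "distr M M (\<tau> ^^ Suc k) = distr (distr M M (\<tau> ^^ k)) M \<tau>"
    by (simp only: distr_distr[OF measurable_\<tau> funpow_measurable] funpow.simps)
  then show ?case by (simp only: Suc distr_\<tau>)
qed

lemma (in fibered_system) sigma_pullbacks_subset_events: "sigma_pullbacks M \<tau> \<alpha> K \<subseteq> events"
  unfolding sigma_pullbacks_def
  using partition_measurable by (intro sets.sigma_sets_subset) (auto intro!: measurable_sets[OF funpow_measurable])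

lemma sigma_pullbacks_mono: "K \<subseteq> L \<Longrightarrow> sigma_pullbacks M \<tau> \<alpha> K \<subseteq> sigma_pullbacks M \<tau> \<alpha> L"
  unfolding sigma_pullbacks_def by (intro sigma_sets_mono') blast

text \<open>Packages the sigma-algebra as a measure space object, so that measurability of functions
  with respect to it can be stated and derived automatically.\<close>

definition pullback_algebra :: "'a measure \<Rightarrow> ('a \<Rightarrow> 'a) \<Rightarrow> 'a set set \<Rightarrow> nat set \<Rightarrow> 'a measure" where
  "pullback_algebra M \<tau> \<alpha> K = sigma (space M) (sigma_pullbacks M \<tau> \<alpha> K)"

lemma space_pullback_algebra[simp]: "space (pullback_algebra M \<tau> \<alpha> K) = space M"
  by (simp add: pullback_algebra_def space_measure_of_conv)

lemma sets_pullback_algebra[simp]: "sets (pullback_algebra M \<tau> \<alpha> K) = sigma_pullbacks M \<tau> \<alpha> K"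
proof -
  interpret sigma_algebra "space M" "sigma_pullbacks M \<tau> \<alpha> K"
    unfolding sigma_pullbacks_def by (rule sigma_algebra_sigma_sets) auto
  show ?thesis
    unfolding pullback_algebra_def by (rule sets_measure_of_eq)
qed

lemma (in fibered_system) funpow_measurable_pullback:
  assumes "k \<in> K"
  shows "\<tau> ^^ k \<in> pullback_algebra M \<tau> \<alpha> K \<rightarrow>\<^sub>M sigma (space M) \<alpha>"
proof (rule measurable_measure_of)
  show "\<alpha> \<subseteq> Pow (space M)"
    using partition_measurable sets.sets_into_space by blast
  show "\<tau> ^^ k \<in> space (pullback_algebra M \<tau> \<alpha> K) \<rightarrow> space M"
    using measurable_space[OF funpow_measurable] by auto
  show "(\<tau> ^^ k) -` a \<inter> space (pullback_algebra M \<tau> \<alpha> K) \<in> sets (pullback_algebra M \<tau> \<alpha> K)"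
    if "a \<in> \<alpha>" for a
    using that assms by (auto simp: sigma_pullbacks_def)
qed

section \<open>Consequences of mixing: an upper bound with gap 1 and a zero-one law\<close>

locale cf_mixing_system = fibered_system +
  fixes \<theta> :: "nat \<Rightarrow> real"
  assumes theta_nonneg: "1 \<le> N \<Longrightarrow> 0 \<le> \<theta> N"
    and theta_lim: "\<theta> \<longlonglongrightarrow> 0"
    and mixing: "1 \<le> n \<Longrightarrow> 1 \<le> N \<Longrightarrow> A \<in> sigma_pullbacks M \<tau> \<alpha> {0..n} \<Longrightarrow>
      B \<in> sigma_pullbacks M \<tau> \<alpha> {n + N..} \<Longrightarrow>
      \<bar>prob (A \<inter> B) - prob A * prob B\<bar> \<le> \<theta> N * prob A * prob B"
begin

text \<open>Every gap \<open>n - m >= 1\<close> is reduced to gap 1 by letting \<open>B\<close>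
  range over the larger sigma-algebra from \<open>m + 1\<close> on. The constant is therefore
  uniform in \<open>m\<close> and \<open>n\<close>.\<close>

lemma prob_Int_le:
  assumes "1 \<le> m" "m < n" "A \<in> sigma_pullbacks M \<tau> \<alpha> {0..m}" "B \<in> sigma_pullbacks M \<tau> \<alpha> {n..}"
  shows "prob (A \<inter> B) \<le> (1 + \<theta> 1) * prob A * prob B"
proof -
  have "B \<in> sigma_pullbacks M \<tau> \<alpha> {m + 1..}"
    using assms sigma_pullbacks_mono[of "{n..}" "{m + 1..}"] by fastforce
  with mixing[of m 1 A B] assms show ?thesis by (simp add: algebra_simps)
qed

text \<open>Kolmogorov's argument: a tail event may be placed at any distance \<open>N\<close> from
  a given finite block of coordinates, and \<open>\<theta> N\<close> tends to 0, so it is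
  independent of that block. The blocks form a generating class stable under intersection, hence the
  event is independent of itself.\<close>

lemma tail_event_trivial:
  assumes tail: "\<And>n. B \<in> sigma_pullbacks M \<tau> \<alpha> {n..}"
  shows "prob B = 0 \<or> prob B = 1"
proof -
  \<comment> \<open>The blocks end at \<open>Suc n\<close> because mixing is assumed only for last
    indices at least 1.\<close>
  define \<A> where "\<A> = (\<Union>n. sigma_pullbacks M \<tau> \<alpha> {0..Suc n})"
  have B: "B \<in> events" using tail sigma_pullbacks_subset_events by blast
  have \<A>: "\<A> \<subseteq> events" unfolding \<A>_def using sigma_pullbacks_subset_events by blast
  have "prob (A \<inter> B) = prob A * prob B" if A\<A>: "A \<in> \<A>" for A
  proof -
    obtain n where A: "A \<in> sigma_pullbacks M \<tau> \<alpha> {0..Suc n}"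
      using A\<A> by (auto simp: \<A>_def)
    have "(\<lambda>N. \<theta> N * prob A * prob B) \<longlonglongrightarrow> 0 * prob A * prob B"
      by (intro tendsto_intros theta_lim)
    then have "\<bar>prob (A \<inter> B) - prob A * prob B\<bar> \<le> 0 * prob A * prob B"
      by (rule LIMSEQ_le_const) (use mixing[OF _ _ A tail] in \<open>auto intro!: exI[of _ 1]\<close>)
    then show ?thesis by simp
  qed
  then have "indep_set \<A> {B}"
    using \<A> B by (intro indep_setI) auto
  moreover have "Int_stable \<A>"
  proof (rule Int_stableI)
    fix a b assume "a \<in> \<A>" "b \<in> \<A>"
    then obtain m n where mn: "a \<in> sigma_pullbacks M \<tau> \<alpha> {0..Suc m}" "b \<in> sigma_pullbacks M \<tau> \<alpha> {0..Suc n}"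
      by (auto simp: \<A>_def)
    have "{0..Suc m} \<subseteq> {0..Suc (max m n)}" "{0..Suc n} \<subseteq> {0..Suc (max m n)}" by auto
    with mn have "a \<in> sets (pullback_algebra M \<tau> \<alpha> {0..Suc (max m n)})"
      "b \<in> sets (pullback_algebra M \<tau> \<alpha> {0..Suc (max m n)})"
      unfolding sets_pullback_algebra using sigma_pullbacks_mono by blast+
    then have "a \<inter> b \<in> sets (pullback_algebra M \<tau> \<alpha> {0..Suc (max m n)})" by (rule sets.Int)
    then show "a \<inter> b \<in> \<A>" by (auto simp: \<A>_def)
  qed
  ultimately have "indep_set (sigma_sets (space M) \<A>) (sigma_sets (space M) {B})"
    by (rule indep_set_sigma_sets) (auto simp: Int_stable_def)
  moreover have "B \<in> sigma_sets (space M) \<A>"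
  proof -
    have "sigma_pullbacks M \<tau> \<alpha> {0..} \<subseteq> sigma_sets (space M) \<A>"
      unfolding sigma_pullbacks_def
    proof (intro sigma_sets_mono subsetI, elim CollectE exE conjE)
      fix x k a assume "x = (\<tau> ^^ k) -` a \<inter> space M" "a \<in> \<alpha>"
      then have "x \<in> sigma_pullbacks M \<tau> \<alpha> {0..Suc k}"
        unfolding sigma_pullbacks_def by (intro sigma_sets.Basic) force
      then show "x \<in> sigma_sets (space M) \<A>"
        by (auto simp: \<A>_def)
    qed
    then show ?thesis using tail[of 0] by blast
  qed
  ultimately have "prob (B \<inter> B) = prob B * prob B"
    by (rule indep_setD) auto
  then show ?thesis by simp
qed

end

section \<open>The observable along an orbit\<close>

lemma frequently_le_limsup:
  fixes f :: "nat \<Rightarrow> 'a::complete_linorder"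
  assumes "\<exists>\<^sub>\<infinity>n. a \<le> f n"
  shows "a \<le> limsup f"
  unfolding limsup_INF_SUP
proof (rule INF_greatest)
  fix m
  obtain n where "m \<le> n" "a \<le> f n"
    using assms by (auto simp: INFM_nat_le)
  then show "a \<le> (SUP n\<in>{m..}. f n)"
    by (intro SUP_upper2[of n]) auto
qed

locale cf_mixing_observable = cf_mixing_system +
  fixes \<Phi> :: "'a \<Rightarrow> nat"
  assumes Phi_pos: "\<omega> \<in> space M \<Longrightarrow> 1 \<le> \<Phi> \<omega>"
    and Phi_meas: "\<Phi> \<in> sigma (space M) \<alpha> \<rightarrow>\<^sub>M count_space UNIV"
begin

definition X :: "nat \<Rightarrow> 'a \<Rightarrow> nat" where "X k \<omega> = \<Phi> ((\<tau> ^^ k) \<omega>)"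

lemma X_measurable_pullback:
  "k \<in> K \<Longrightarrow> X k \<in> pullback_algebra M \<tau> \<alpha> K \<rightarrow>\<^sub>M count_space UNIV"
  unfolding X_def[abs_def]
  by (rule measurable_compose[OF funpow_measurable_pullback Phi_meas])

lemma X_measurable[measurable]: "X k \<in> M \<rightarrow>\<^sub>M count_space UNIV"
  using X_measurable_pullback[of k UNIV] sigma_pullbacks_subset_events[of UNIV]
  by (auto simp: measurable_def)

lemma Phi_measurable[measurable]: "\<Phi> \<in> M \<rightarrow>\<^sub>M count_space UNIV"
  using X_measurable[of 0] by (simp add: X_def[abs_def])

lemma X_pos: "\<omega> \<in> space M \<Longrightarrow> 1 \<le> X k \<omega>"
  unfolding X_def using measurable_space[OF funpow_measurable] by (intro Phi_pos) auto

lemma prob_X: "prob {\<omega> \<in> space M. P (X k \<omega>)} = prob {\<omega> \<in> space M. P (\<Phi> \<omega>)}"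
proof -
  have "prob {\<omega> \<in> space M. P (\<Phi> \<omega>)} = measure (distr M M (\<tau> ^^ k)) {\<omega> \<in> space M. P (\<Phi> \<omega>)}"
    by (simp add: distr_funpow)
  also have "\<dots> = prob ((\<tau> ^^ k) -` {\<omega> \<in> space M. P (\<Phi> \<omega>)} \<inter> space M)"
    by (rule measure_distr) auto
  also have "(\<tau> ^^ k) -` {\<omega> \<in> space M. P (\<Phi> \<omega>)} \<inter> space M = {\<omega> \<in> space M. P (X k \<omega>)}"
    using measurable_space[OF funpow_measurable] by (auto simp: X_def)
  finally show ?thesis by simp
qed

lemma trunc_mean_X: "trunc_mean (X k) t = trunc_mean \<Phi> t"
proof -
  have "trunc_mean \<Phi> t = (\<integral>\<omega>. min (real (\<Phi> \<omega>)) (real t) \<partial>distr M M (\<tau> ^^ k))"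
    by (simp add: distr_funpow trunc_mean_def)
  also have "\<dots> = trunc_mean (X k) t"
    unfolding trunc_mean_def X_def by (rule integral_distr) auto
  finally show ?thesis by simp
qed

lemma sum_X_ge:
  assumes "\<omega> \<in> space M"
  shows "real (n - m) \<le> (\<Sum>k=m..<n. real (X k \<omega>))"
proof -
  have "(\<Sum>k=m..<n. 1) \<le> (\<Sum>k=m..<n. real (X k \<omega>))"
    using X_pos[OF assms] by (intro sum_mono) fastforce
  then show ?thesis by simp
qed

text \<open>Sequences in \<open>seq_extravagance\<close> start at index 1, which shifts the orbit by
  one. The branch for the zero sequence is excluded by \<open>X 0 >= 1\<close>.\<close>

lemma extravagance_eq:
  assumes "\<omega> \<in> space M"
  shows "extravagance (\<lambda>\<omega>. real (\<Phi> \<omega>)) \<tau> \<omega>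
    = limsup (\<lambda>n. ennreal (real (X n \<omega>) / (\<Sum>k<n. real (X k \<omega>))))"
proof -
  have "(\<Sum>k=1..n. real (\<Phi> ((\<tau> ^^ (k - 1)) \<omega>))) = (\<Sum>k<n. real (X k \<omega>))" for n
    unfolding X_def by (rule sum.reindex_bij_witness[of _ Suc "\<lambda>k. k - 1"]) auto
  moreover have "\<not> (\<forall>n\<ge>1. real (\<Phi> ((\<tau> ^^ (n - 1)) \<omega>)) = 0)"
    using X_pos[OF assms, of 0] by (auto simp: X_def intro!: exI[of _ 1])
  ultimately show ?thesis
    unfolding extravagance_def seq_extravagance_def by (simp only: if_False add_diff_cancel_right' X_def)
qed

section \<open>Infinite expectation\<close>

lemma prob_sum_X_gt_le:
  assumes "1 \<le> t"
  shows "prob {\<omega> \<in> space M. real t < (\<Sum>k<n. real (X k \<omega>))} \<le> n * trunc_mean \<Phi> t / t"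
proof -
  define Y where "Y \<omega> = (\<Sum>k<n. min (real (X k \<omega>)) (real t))" for \<omega>
  have Y_int: "integrable M Y"
    unfolding Y_def[abs_def] by (intro Bochner_Integration.integrable_sum integrable_trunc X_measurable)
  \<comment> \<open>If no term exceeds \<open>t\<close>, capping changes nothing; otherwise a single
    capped term already contributes \<open>t\<close>. Markov's inequality can thus be applied to the
    integrable sum \<open>Y\<close>.\<close>
  have "real t \<le> Y \<omega>" if "real t < (\<Sum>k<n. real (X k \<omega>))" for \<omega>
  proof (cases "\<forall>k<n. X k \<omega> \<le> t")
    case True
    then have "Y \<omega> = (\<Sum>k<n. real (X k \<omega>))"
      unfolding Y_def by (intro sum.cong) auto
    with that show ?thesis by simp
  next
    case False
    then obtain k where "k < n" "t < X k \<omega>" by auto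
    then have "real t \<le> min (real (X k \<omega>)) (real t)" by simp
    also have "\<dots> \<le> Y \<omega>"
      unfolding Y_def using \<open>k < n\<close> by (intro member_le_sum) auto
    finally show ?thesis .
  qed
  then have "prob {\<omega> \<in> space M. real t < (\<Sum>k<n. real (X k \<omega>))} \<le> prob {\<omega> \<in> space M. real t \<le> Y \<omega>}"
    by (intro finite_measure_mono) (auto simp: Y_def)
  also have "\<dots> \<le> expectation Y / real t"
    using assms by (intro integral_Markov_inequality_measure[OF Y_int sets.empty_sets])
      (auto simp: Y_def intro!: sum_nonneg)
  also have "expectation Y = n * trunc_mean \<Phi> t"
    unfolding Y_def[abs_def]
    by (subst Bochner_Integration.integral_sum)
       (auto simp: integrable_trunc trunc_mean_X simp flip: trunc_mean_def)
  finally show ?thesis .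
qed

lemma prob_exceed_infinitely_often:
  assumes inf: "(\<integral>\<^sup>+\<omega>. ennreal (real (\<Phi> \<omega>)) \<partial>M) = \<infinity>" and K: "1 \<le> (K::nat)"
  shows "0 < prob {\<omega> \<in> space M. \<exists>\<^sub>\<infinity>n. K * (\<Sum>k<n. real (X k \<omega>)) < X n \<omega>}"
proof -
  define q where "q = 1 + \<theta> 1"
  have q: "1 \<le> q" using theta_nonneg[of 1] by (simp add: q_def)
  \<comment> \<open>Chosen so that \<open>q * c = 1/2\<close>: removing \<open>D n\<close> from
    \<open>E n\<close> then costs at most half of its probability.\<close>
  define c where "c = 1 / (2 * q)"
  have c: "0 < c" using q by (simp add: c_def)
  define good where "good n s \<longleftrightarrow> 1 \<le> s \<and> real n * trunc_mean \<Phi> s \<le> c * real s" for n s :: nat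
  define t where "t n = (LEAST s. good n s)" for n
  have ex: "\<exists>s. good n s" for n
  proof -
    \<comment> \<open>The denominator \<open>n + 1\<close> instead of \<open>n\<close> includes the
      case \<open>n = 0\<close>.\<close>
    have "\<forall>\<^sub>F s in sequentially. trunc_mean \<Phi> s / real s < c / (real n + 1)"
      using c by (intro order_tendstoD(2)[OF trunc_mean_div_tendsto_0]) auto
    then have "\<forall>\<^sub>F s in sequentially. trunc_mean \<Phi> s / real s < c / (real n + 1) \<and> 1 \<le> s"
      using eventually_ge_at_top[of 1] by eventually_elim auto
    then obtain s where s: "trunc_mean \<Phi> s / real s < c / (real n + 1)" "1 \<le> s"
      by (auto dest: eventually_happens)
    then have "(real n + 1) * trunc_mean \<Phi> s \<le> c * real s"
      by (simp add: field_simps)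
    then have "good n s"
      using s trunc_mean_nonneg[OF Phi_measurable, of s] by (simp add: good_def distrib_right)
    then show ?thesis ..
  qed
  have t_good: "1 \<le> t n" "real n * trunc_mean \<Phi> (t n) \<le> c * real (t n)" for n
    using LeastI_ex[OF ex[of n]] by (auto simp: t_def good_def)
  have t_le: "t n \<le> s" if "1 \<le> s" "real n * trunc_mean \<Phi> s \<le> c * real s" for n s
    unfolding t_def by (rule Least_le) (use that in \<open>simp add: good_def\<close>)
  define E where "E n = {\<omega> \<in> space M. K * t n < X n \<omega>}" for n
  define D where "D n = {\<omega> \<in> space M. real (t n) < (\<Sum>k<n. real (X k \<omega>))}" for n
  \<comment> \<open>On \<open>A n\<close> the sum of the earlier terms is at most
    \<open>t n\<close>, so \<open>K\<close> times it is below \<open>X n\<close>. \<open>E n\<close>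
    depends only on coordinate \<open>n\<close> and \<open>D n\<close> only on earlier ones, which
    is what mixing requires.\<close>
  define A where "A n = E n - D n" for n
  have E_ev[measurable]: "E n \<in> events" and D_ev[measurable]: "D n \<in> events" for n
    unfolding E_def D_def by measurable
  have A_ev: "A n \<in> events" for n unfolding A_def by measurable
  have E_pull: "E n \<in> sigma_pullbacks M \<tau> \<alpha> L" if "n \<in> L" for n L
  proof -
    have [measurable]: "X n \<in> pullback_algebra M \<tau> \<alpha> L \<rightarrow>\<^sub>M count_space UNIV"
      using that by (rule X_measurable_pullback)
    have "{\<omega> \<in> space (pullback_algebra M \<tau> \<alpha> L). K * t n < X n \<omega>} \<in> sets (pullback_algebra M \<tau> \<alpha> L)"
      by measurable
    then show ?thesis by (simp add: E_def)
  qed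
  have D_pull: "D (Suc n) \<in> sigma_pullbacks M \<tau> \<alpha> {0..n}" for n
  proof -
    have "(\<lambda>\<omega>. \<Sum>k<Suc n. real (X k \<omega>)) \<in> borel_measurable (pullback_algebra M \<tau> \<alpha> {0..n})"
      by (intro borel_measurable_sum measurable_compose[OF X_measurable_pullback]) auto
    then have "{\<omega> \<in> space (pullback_algebra M \<tau> \<alpha> {0..n}). real (t (Suc n)) < (\<Sum>k<Suc n. real (X k \<omega>))}
        \<in> sets (pullback_algebra M \<tau> \<alpha> {0..n})"
      by measurable
    then show ?thesis by (simp add: D_def)
  qed
  \<comment> \<open>With \<open>2 <= n\<close> the past of \<open>n\<close> ends at an index at
    least 1, as \<open>prob_Int_le\<close> demands.\<close>
  have pA: "prob (E n) \<le> 2 * prob (A n)" if n: "2 \<le> n" for n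
  proof -
    obtain m where m: "n = Suc m" "1 \<le> m" using n by (cases n) auto
    have "prob (D n \<inter> E n) \<le> q * prob (D n) * prob (E n)"
      unfolding q_def using m D_pull E_pull by (intro prob_Int_le[of m n]) auto
    also have "prob (D n) \<le> c"
    proof -
      have "prob (D n) \<le> n * trunc_mean \<Phi> (t n) / t n"
        unfolding D_def by (rule prob_sum_X_gt_le[OF t_good(1)])
      also have "\<dots> \<le> c"
        using t_good[of n] by (simp add: divide_le_eq)
      finally show ?thesis .
    qed
    then have "q * prob (D n) * prob (E n) \<le> q * c * prob (E n)"
      using q by (intro mult_right_mono mult_left_mono) auto
    also have "\<dots> = prob (E n) / 2"
      using q by (simp add: c_def)
    finally have "prob (D n \<inter> E n) \<le> prob (E n) / 2" .
    moreover have "prob (A n) = prob (E n) - prob (E n \<inter> D n)"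
      unfolding A_def by (rule finite_measure_Diff') auto
    ultimately show ?thesis by (simp add: Int_commute)
  qed
  have div: "\<not> summable (\<lambda>n. prob (A n))"
  proof
    assume "summable (\<lambda>n. prob (A n))"
    then have "summable (\<lambda>n. 2 * prob (A n))"
      by (rule summable_mult)
    then have "summable (\<lambda>n. prob (E n))"
      by (rule summable_comparison_test'[where N = 2]) (use pA in simp)
    moreover have "prob (E n) = prob {\<omega> \<in> space M. K * t n < \<Phi> \<omega>}" for n
      unfolding E_def by (rule prob_X)
    ultimately show False
      using not_summable_tail[OF Phi_measurable Phi_pos inf c K, of t] t_le by simp
  qed
  have quasi: "prob (A m \<inter> A n) \<le> (4 * q) * prob (A m) * prob (A n)" if "2 \<le> m" "m < n" for m n
  proof -
    have "prob (A m \<inter> A n) \<le> prob (E m \<inter> E n)"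
      by (intro finite_measure_mono) (auto simp: A_def)
    also have "\<dots> \<le> q * prob (E m) * prob (E n)"
      unfolding q_def using that E_pull by (intro prob_Int_le) auto
    \<comment> \<open>Passing back from \<open>E\<close> to \<open>A\<close> costs a factor 2 for
      each of the two events, whence \<open>4 * q\<close>.\<close>
    also have "\<dots> \<le> q * (2 * prob (A m)) * (2 * prob (A n))"
      using that q pA by (intro mult_mono) auto
    finally show ?thesis by (simp add: mult_ac)
  qed
  have "0 < 1 / (4 * q + 1)" using q by simp
  also have "\<dots> \<le> prob {\<omega> \<in> space M. \<exists>\<^sub>\<infinity>n. \<omega> \<in> A n}"
    using q by (intro kochen_stone[OF A_ev div _ quasi]) auto
  also have "\<dots> \<le> prob {\<omega> \<in> space M. \<exists>\<^sub>\<infinity>n. K * (\<Sum>k<n. real (X k \<omega>)) < X n \<omega>}"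
  proof (rule finite_measure_mono)
    have "K * (\<Sum>k<n. real (X k \<omega>)) < X n \<omega>" if "\<omega> \<in> A n" for \<omega> n
    proof -
      have "(\<Sum>k<n. real (X k \<omega>)) \<le> t n" "K * t n < X n \<omega>"
        using that by (auto simp: A_def E_def D_def)
      moreover from this have "K * (\<Sum>k<n. real (X k \<omega>)) \<le> K * real (t n)"
        by (intro mult_left_mono) auto
      moreover have "K * real (t n) = real (K * t n)"
        by simp
      ultimately show ?thesis by linarith
    qed
    then show "{\<omega> \<in> space M. \<exists>\<^sub>\<infinity>n. \<omega> \<in> A n} \<subseteq> {\<omega> \<in> space M. \<exists>\<^sub>\<infinity>n. K * (\<Sum>k<n. real (X k \<omega>)) < X n \<omega>}"
      by (auto elim: frequently_elim1)
    show "{\<omega> \<in> space M. \<exists>\<^sub>\<infinity>n. K * (\<Sum>k<n. real (X k \<omega>)) < X n \<omega>} \<in> events"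
      unfolding INFM_nat_le by measurable
  qed
  finally show ?thesis .
qed

text \<open>Allowing the sum to start at an arbitrary \<open>m\<close> makes the condition
  insensitive to any finite number of coordinates, so the zero-one law applies. The case
  \<open>m = 0\<close> already has positive probability.\<close>

lemma AE_exceed_tail_sums:
  assumes inf: "(\<integral>\<^sup>+\<omega>. ennreal (real (\<Phi> \<omega>)) \<partial>M) = \<infinity>" and K: "1 \<le> (K::nat)"
  shows "AE \<omega> in M. \<exists>m. \<exists>\<^sub>\<infinity>n. K * (\<Sum>k=m..<n. real (X k \<omega>)) < X n \<omega>"
proof -
  define H where "H = {\<omega> \<in> space M. \<exists>m. \<exists>\<^sub>\<infinity>n. K * (\<Sum>k=m..<n. real (X k \<omega>)) < X n \<omega>}"
  have tail: "H \<in> sigma_pullbacks M \<tau> \<alpha> {r..}" for r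
  proof -
    let ?G = "pullback_algebra M \<tau> \<alpha> {r..}"
    \<comment> \<open>Only indices \<open>\<ge> r\<close> occur in this form, because enlarging \<open>m\<close> weakens the condition defining \<open>H\<close>.\<close>
    have "H = {\<omega> \<in> space ?G. \<exists>j. \<forall>i. \<exists>l. K * (\<Sum>k=r+j..<r+i+l. real (X k \<omega>)) < X (r+i+l) \<omega>}"
      (is "_ = ?H'")
    proof (intro set_eqI iffI)
      fix \<omega> assume "\<omega> \<in> H"
      then obtain m where \<omega>: "\<omega> \<in> space M" and m: "\<exists>\<^sub>\<infinity>n. K * (\<Sum>k=m..<n. real (X k \<omega>)) < X n \<omega>"
        by (auto simp: H_def)
      have "\<exists>l. K * (\<Sum>k=r+m..<r+i+l. real (X k \<omega>)) < X (r+i+l) \<omega>" for i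
      proof -
        obtain n where n: "r + i \<le> n" "K * (\<Sum>k=m..<n. real (X k \<omega>)) < X n \<omega>"
          using m by (auto simp: INFM_nat_le)
        have "K * (\<Sum>k=r+m..<n. real (X k \<omega>)) \<le> K * (\<Sum>k=m..<n. real (X k \<omega>))"
          by (intro mult_left_mono sum_mono2) auto
        with n show ?thesis by (intro exI[of _ "n - (r + i)"]) auto
      qed
      then show "\<omega> \<in> ?H'" using \<omega> by auto
    next
      fix \<omega> assume "\<omega> \<in> ?H'"
      then obtain j where \<omega>: "\<omega> \<in> space M"
        and j: "\<And>i. \<exists>l. K * (\<Sum>k=r+j..<r+i+l. real (X k \<omega>)) < X (r+i+l) \<omega>"
        by auto
      have "\<exists>\<^sub>\<infinity>n. K * (\<Sum>k=r+j..<n. real (X k \<omega>)) < X n \<omega>"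
        unfolding INFM_nat_le
      proof
        fix i
        obtain l where "K * (\<Sum>k=r+j..<r+i+l. real (X k \<omega>)) < X (r+i+l) \<omega>"
          using j by blast
        then show "\<exists>n\<ge>i. K * (\<Sum>k=r+j..<n. real (X k \<omega>)) < X n \<omega>"
          by (intro exI[of _ "r + i + l"]) auto
      qed
      then show "\<omega> \<in> H" using \<omega> by (auto simp: H_def)
    qed
    moreover have [measurable]: "X (r+i+l) \<in> ?G \<rightarrow>\<^sub>M count_space UNIV" for i l
      by (rule X_measurable_pullback) auto
    have [measurable]: "(\<lambda>\<omega>. \<Sum>k=r+j..<r+i+l. real (X k \<omega>)) \<in> borel_measurable ?G" for i j l
      by (intro borel_measurable_sum measurable_compose[OF X_measurable_pullback]) auto
    have "?H' \<in> sets ?G" by measurable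
    ultimately show ?thesis by simp
  qed
  have H_ev: "H \<in> events" using tail sigma_pullbacks_subset_events by blast
  have "{\<omega> \<in> space M. \<exists>\<^sub>\<infinity>n. K * (\<Sum>k<n. real (X k \<omega>)) < X n \<omega>} \<subseteq> H"
    unfolding H_def lessThan_atLeast0 by blast
  then have "prob {\<omega> \<in> space M. \<exists>\<^sub>\<infinity>n. K * (\<Sum>k<n. real (X k \<omega>)) < X n \<omega>} \<le> prob H"
    by (rule finite_measure_mono) (rule H_ev)
  then have "prob H = 1"
    using prob_exceed_infinitely_often[OF inf K] tail_event_trivial[OF tail] by linarith
  then show ?thesis
    using AE_prob_1[of H] by (auto simp: H_def)
qed

lemma extravagance_infinite:
  assumes inf: "(\<integral>\<^sup>+\<omega>. ennreal (real (\<Phi> \<omega>)) \<partial>M) = \<infinity>"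
  shows "AE \<omega> in M. extravagance (\<lambda>\<omega>. real (\<Phi> \<omega>)) \<tau> \<omega> = \<infinity>"
proof -
  have "AE \<omega> in M. \<forall>j::nat. \<exists>m. \<exists>\<^sub>\<infinity>n. Suc j * (\<Sum>k=m..<n. real (X k \<omega>)) < X n \<omega>"
    unfolding AE_all_countable by (intro allI AE_exceed_tail_sums[OF inf]) simp
  with AE_space show ?thesis
  proof eventually_elim
    case (elim \<omega>)
    define S where "S n = (\<Sum>k<n. real (X k \<omega>))" for n
    have "ennreal (real J) \<le> limsup (\<lambda>n. ennreal (real (X n \<omega>) / S n))" for J :: nat
    proof (rule frequently_le_limsup)
      define j where "j = 2 * J"
      obtain m where m: "\<exists>\<^sub>\<infinity>n. Suc j * (\<Sum>k=m..<n. real (X k \<omega>)) < X n \<omega>"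
        using elim by blast
      \<comment> \<open>For \<open>n >= r\<close> the terms from \<open>m\<close> on, each at least
        1, add up to at least \<open>S m\<close>. So \<open>S n\<close> is at most twice this tail
        sum, and \<open>j = 2 * J\<close> absorbs the factor 2.\<close>
      define r where "r = Suc (m + nat \<lceil>S m\<rceil>)"
      have "\<exists>\<^sub>\<infinity>n. r \<le> n \<and> Suc j * (\<Sum>k=m..<n. real (X k \<omega>)) < X n \<omega>"
        using m by (auto simp: INFM_nat_le) (metis le_trans max.cobounded1 max.cobounded2)
      then show "\<exists>\<^sub>\<infinity>n. ennreal (real J) \<le> ennreal (real (X n \<omega>) / S n)"
      proof (rule frequently_elim1, elim conjE)
        fix n assume n: "r \<le> n" and lt: "Suc j * (\<Sum>k=m..<n. real (X k \<omega>)) < X n \<omega>"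
        define U where "U = (\<Sum>k=m..<n. real (X k \<omega>))"
        have "{..<n} = {..<m} \<union> {m..<n}" using n by (auto simp: r_def)
        then have SU: "S n = S m + U"
          unfolding S_def U_def by (simp add: sum.union_disjoint ivl_disj_int)
        have "S m \<le> real (n - m)" using n unfolding r_def by linarith
        also have "\<dots> \<le> U" unfolding U_def by (rule sum_X_ge) (rule elim)
        finally have "S n \<le> 2 * U" using SU by simp
        then have "real J * S n \<le> real J * (2 * U)" by (intro mult_left_mono) auto
        also have "\<dots> \<le> real (Suc j) * U"
          by (auto simp: j_def U_def sum_nonneg distrib_right)
        also have "\<dots> \<le> real (X n \<omega>)" using lt by (simp add: U_def)
        finally have "real J * S n \<le> real (X n \<omega>)" .
        moreover have "0 < S n"
          using sum_X_ge[of \<omega> n 0] elim n by (auto simp: S_def r_def lessThan_atLeast0)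
        ultimately show "ennreal (real J) \<le> ennreal (real (X n \<omega>) / S n)"
          by (intro ennreal_leI) (simp add: pos_le_divide_eq)
      qed
    qed
    then have "\<forall>J::nat. of_nat J \<le> limsup (\<lambda>n. ennreal (real (X n \<omega>) / S n))"
      by (simp add: ennreal_of_nat_eq_real_of_nat)
    then have "limsup (\<lambda>n. ennreal (real (X n \<omega>) / S n)) = \<infinity>"
      by (metis ennreal_Ex_less_of_nat infinity_ennreal_def leD top.not_eq_extremum)
    then show ?case
      using elim by (simp add: extravagance_eq S_def)
  qed
qed

section \<open>Finite expectation\<close>

lemma extravagance_zero:
  assumes fin: "(\<integral>\<^sup>+\<omega>. ennreal (real (\<Phi> \<omega>)) \<partial>M) < \<infinity>"
  shows "AE \<omega> in M. extravagance (\<lambda>\<omega>. real (\<Phi> \<omega>)) \<tau> \<omega> = 0"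
proof -
  have small: "AE \<omega> in M. \<forall>\<^sub>F n in sequentially. Suc j * X n \<omega> \<le> n" for j
  proof -
    \<comment> \<open>Exactly \<open>y\<close> natural numbers lie below a natural number
      \<open>y\<close>, so after interchanging sum and integral the series equals
      \<open>Suc j\<close> times the expectation. Its finiteness feeds Borel-Cantelli.\<close>
    have "(\<Sum>n. ennreal (prob {\<omega> \<in> space M. n < Suc j * \<Phi> \<omega>}))
        = (\<Sum>n. \<integral>\<^sup>+\<omega>. indicator {\<omega> \<in> space M. n < Suc j * \<Phi> \<omega>} \<omega> \<partial>M)"
      by (subst nn_integral_indicator, measurable) (simp only: emeasure_eq_measure)
    also have "\<dots> = (\<integral>\<^sup>+\<omega>. (\<Sum>n. indicator {\<omega> \<in> space M. n < Suc j * \<Phi> \<omega>} \<omega>) \<partial>M)"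
      by (rule nn_integral_suminf[symmetric]) measurable
    also have "\<dots> = (\<integral>\<^sup>+\<omega>. ennreal (real (Suc j)) * ennreal (real (\<Phi> \<omega>)) \<partial>M)"
    proof (rule nn_integral_cong)
      fix \<omega> assume \<omega>: "\<omega> \<in> space M"
      have "(\<Sum>n. indicator {\<omega> \<in> space M. n < Suc j * \<Phi> \<omega>} \<omega> :: ennreal)
          = (\<Sum>n<Suc j * \<Phi> \<omega>. indicator {\<omega> \<in> space M. n < Suc j * \<Phi> \<omega>} \<omega>)"
        by (rule suminf_finite) (auto simp: indicator_def)
      also have "\<dots> = (\<Sum>n<Suc j * \<Phi> \<omega>. 1)"
        using \<omega> by (intro sum.cong) (auto simp: indicator_def)
      also have "\<dots> = ennreal (real (Suc j * \<Phi> \<omega>))"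
        by (simp only: sum_constant card_lessThan mult_1_right ennreal_of_nat_eq_real_of_nat)
      also have "\<dots> = ennreal (real (Suc j)) * ennreal (real (\<Phi> \<omega>))"
        by (simp only: of_nat_mult ennreal_mult of_nat_0_le_iff)
      finally show "(\<Sum>n. indicator {\<omega> \<in> space M. n < Suc j * \<Phi> \<omega>} \<omega> :: ennreal)
          = ennreal (real (Suc j)) * ennreal (real (\<Phi> \<omega>))" .
    qed
    also have "\<dots> = ennreal (real (Suc j)) * (\<integral>\<^sup>+\<omega>. ennreal (real (\<Phi> \<omega>)) \<partial>M)"
      by (rule nn_integral_cmult) measurable
    also have "\<dots> < \<infinity>"
      using fin by (auto intro: ennreal_mult_less_top[THEN iffD2])
    finally have "(\<Sum>n. ennreal (prob {\<omega> \<in> space M. n < Suc j * \<Phi> \<omega>})) \<noteq> top"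
      by (metis infinity_ennreal_def less_irrefl)
    then have "summable (\<lambda>n. prob {\<omega> \<in> space M. n < Suc j * \<Phi> \<omega>})"
      by (intro summable_suminf_not_top) auto
    moreover have "prob {\<omega> \<in> space M. n < Suc j * X n \<omega>} = prob {\<omega> \<in> space M. n < Suc j * \<Phi> \<omega>}" for n
      by (rule prob_X)
    ultimately have "AE \<omega> in M. \<forall>\<^sub>F n in sequentially. \<omega> \<in> space M - {\<omega> \<in> space M. n < Suc j * X n \<omega>}"
      by (intro borel_cantelli_AE1) (auto simp: emeasure_eq_measure)
    then show ?thesis
      by (rule AE_mp) (auto simp: not_less elim!: eventually_mono)
  qed
  have "AE \<omega> in M. \<forall>j. \<forall>\<^sub>F n in sequentially. Suc j * X n \<omega> \<le> n"
    unfolding AE_all_countable by (intro allI small)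
  with AE_space show ?thesis
  proof eventually_elim
    case (elim \<omega>)
    define e where "e = limsup (\<lambda>n. ennreal (real (X n \<omega>) / (\<Sum>k<n. real (X k \<omega>))))"
    have "e \<le> ennreal (1 / real (Suc j))" for j
      unfolding e_def
    proof (rule Limsup_bounded)
      have "\<forall>\<^sub>F n in sequentially. Suc j * X n \<omega> \<le> n" using elim by blast
      then show "\<forall>\<^sub>F n in sequentially. ennreal (real (X n \<omega>) / (\<Sum>k<n. real (X k \<omega>))) \<le> ennreal (1 / real (Suc j))"
        using eventually_ge_at_top[of 1]
      proof eventually_elim
        case (elim n)
        define S where "S = (\<Sum>k<n. real (X k \<omega>))"
        \<comment> \<open>All terms are at least 1, so the bound \<open>X n <= n / Suc j\<close>
          becomes a bound relative to the partial sum. Letting \<open>j\<close> grow then forces the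
          limsup to 0.\<close>
        have S: "real n \<le> S"
          using sum_X_ge[of \<omega> n 0] \<open>\<omega> \<in> space M\<close> by (simp add: S_def lessThan_atLeast0)
        have "real (Suc j) * real (X n \<omega>) \<le> real n"
          using elim by (metis of_nat_le_iff of_nat_mult)
        with S have "real (Suc j) * real (X n \<omega>) \<le> S" by linarith
        moreover have "0 < S" using S elim by linarith
        ultimately have "real (X n \<omega>) / S \<le> 1 / real (Suc j)"
          by (simp add: field_simps del: of_nat_Suc)
        then show ?case unfolding S_def by (rule ennreal_leI)
      qed
    qed
    moreover have "(\<lambda>j. ennreal (1 / real (Suc j))) \<longlonglongrightarrow> ennreal 0"
      by (intro tendsto_ennrealI lim_1_over_n[THEN LIMSEQ_Suc])
    ultimately have "e \<le> ennreal 0"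
      by (intro LIMSEQ_le_const) auto
    then show ?case
      using elim by (simp add: extravagance_eq e_def)
  qed
qed

end

theorem mainTheorem1:
  fixes M :: "'a measure" and \<tau> :: "'a \<Rightarrow> 'a" and \<alpha> :: "'a set set" and \<Phi> :: "'a \<Rightarrow> nat"
  assumes "fibered_system M \<tau> \<alpha>"
    and "continued_fraction_mixing M \<tau> \<alpha>"
    and "\<And>\<omega>. \<omega> \<in> space M \<Longrightarrow> 1 \<le> \<Phi> \<omega>"
    and "\<Phi> \<in> sigma (space M) \<alpha> \<rightarrow>\<^sub>M count_space UNIV"
  shows "((\<integral>\<^sup>+\<omega>. ennreal (real (\<Phi> \<omega>)) \<partial>M) < \<infinity> \<longrightarrow>
            (AE \<omega> in M. extravagance (\<lambda>\<omega>. real (\<Phi> \<omega>)) \<tau> \<omega> = 0)) \<and>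
         ((\<integral>\<^sup>+\<omega>. ennreal (real (\<Phi> \<omega>)) \<partial>M) = \<infinity> \<longrightarrow>
            (AE \<omega> in M. extravagance (\<lambda>\<omega>. real (\<Phi> \<omega>)) \<tau> \<omega> = \<infinity>))"
proof -
  interpret fibered_system M \<tau> \<alpha> by fact
  obtain \<theta> :: "nat \<Rightarrow> real" where "\<forall>N\<ge>1. 0 \<le> \<theta> N" "\<theta> \<longlonglongrightarrow> 0"
    "\<forall>n\<ge>1. \<forall>N\<ge>1. \<forall>A \<in> sigma_pullbacks M \<tau> \<alpha> {0..n}. \<forall>B \<in> sigma_pullbacks M \<tau> \<alpha> {n + N..}.
       \<bar>measure M (A \<inter> B) - measure M A * measure M B\<bar> \<le> \<theta> N * measure M A * measure M B"
    using assms(2) unfolding continued_fraction_mixing_def by blast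
  then interpret cf_mixing_observable M \<tau> \<alpha> \<theta> \<Phi>
    using assms(3,4) by unfold_locales auto
  show ?thesis
    using extravagance_zero extravagance_infinite by blast
qed

end
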